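(* Let $N,r,\beta_1,\dots,\beta_r$ be positive integers, let $p$ be a prime number, and put $A:=(\mathbb{Z}/p\mathbb{Z})^N$. For each $1\le j\le r$, let $f_j: A\to \mathbb{Z}/p^{\beta_j}\mathbb{Z}$ be a nonzero function (that is, not identically zero). Put $Z:=\{x\in A\mid f_1(x)=0,\dots,f_r(x)=0\}$. Then $$\operatorname{ord}_p(\#Z)\;\ge\;\left\lceil\frac{N-\sum_{j=1}^r\frac{p^{\beta_j}-1}{p-1}\operatorname{fdeg}(f_j)}{\max_{1\le j\le r}\,p^{\beta_j-1}\operatorname{fdeg}(f_j)}\right\rceil .$$
   Context: For commutative groups $A,B$, a function $f:A\to B$ and $a\in A$, let $\Delta_a f:A\to B$ be $\Delta_a f(x)=f(x+a)-f(x)$. The functional degree is $$\operatorname{fdeg}(f)=\sup\{n\in\mathbb{N}\mid \exists\, a_1,\dots,a_n\in A,\ \Delta_{a_1}\cdots\Delta_{a_n}f\ne 0\}\in\mathbb{N}\cup\{-\infty,\infty\},$$ where $\mathbb{N}=\{0,1,2,\dots\}$ and $\sup\emptyset=-\infty$. (In the situation of the claim all functional degrees are finite and non-negative.) For a nonzero integer $m$, $\operatorname{ord}_p(m)$ is the exponent of the largest power of $p$ dividing $m$, and $\operatorname{ord}_p(0)=\infty$. If the maximum in the denominator is $0$ (all $f_j$ are nonzero constants), the right-hand side is read as $+\infty$. *)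

theory Defs
  imports
    "HOL-Algebra.Elementary_Groups"
    "HOL-Algebra.Product_Groups"
    "HOL-Computational_Algebra.Primes"
    "HOL-Library.Extended_Real"
begin

text \<open>
  Commutative groups are HOL-Algebra groups, hence written multiplicatively: the zero of the
  codomain \<open>B\<close> is \<open>\<one>\<^bsub>B\<^esub>\<close>. Only the values of functions on \<open>carrier A\<close> are meaningful.
\<close>

definition fdiff ::
  "('a, 'c) monoid_scheme \<Rightarrow> ('b, 'd) monoid_scheme \<Rightarrow> 'a \<Rightarrow> ('a \<Rightarrow> 'b) \<Rightarrow> 'a \<Rightarrow> 'b"
  where "fdiff A B a f = (\<lambda>x. f (x \<otimes>\<^bsub>A\<^esub> a) \<otimes>\<^bsub>B\<^esub> inv\<^bsub>B\<^esub> (f x))"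

definition nonzero_fun ::
  "('a, 'c) monoid_scheme \<Rightarrow> ('b, 'd) monoid_scheme \<Rightarrow> ('a \<Rightarrow> 'b) \<Rightarrow> bool"
  where "nonzero_fun A B f \<longleftrightarrow> (\<exists>x\<in>carrier A. f x \<noteq> \<one>\<^bsub>B\<^esub>)"

text \<open>In \<^typ>\<open>ereal\<close> the supremum of the empty set is \<open>-\<infinity>\<close>.\<close>

definition fdeg ::
  "('a, 'c) monoid_scheme \<Rightarrow> ('b, 'd) monoid_scheme \<Rightarrow> ('a \<Rightarrow> 'b) \<Rightarrow> ereal"
  where "fdeg A B f = Sup {ereal (real n) | n :: nat.
    \<exists>as. length as = n \<and> set as \<subseteq> carrier A \<and> nonzero_fun A B (foldr (fdiff A B) as f)}"

definition ord_p :: "nat \<Rightarrow> int \<Rightarrow> ereal"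
  where "ord_p p m = (if m = 0 then \<infinity> else ereal (real (multiplicity (int p) m)))"

definition ereal_ceiling :: "ereal \<Rightarrow> ereal"
  where "ereal_ceiling x =
    (case x of ereal t \<Rightarrow> ereal (real_of_int \<lceil>t\<rceil>) | PInfty \<Rightarrow> \<infinity> | MInfty \<Rightarrow> -\<infinity>)"

end

theory Submission
  imports Defs "HOL-Computational_Algebra.Polynomial"
begin

text \<open>
  Identify \<open>A\<close> with the box \<open>{0..<p} ^ N\<close>. Truncating its Newton series, a function
  \<open>A \<rightarrow> \<int> / p ^ \<beta>\<close> of functional degree \<open>d\<close> lifts to an \<open>\<nat>\<close>-valued polynomial \<open>F\<close> of degree at
  most \<open>d\<close> on the box. The indicator of \<open>p ^ \<beta>\<close> dividing \<open>y\<close> is a Newton series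
  \<open>\<Sum>k. c\<^sub>k (y choose k)\<close> in which, by Weisman's congruence, \<open>c\<^sub>k\<close> is divisible by \<open>p ^ e\<close> with
  \<open>e = \<lfloor>(k - p ^ (\<beta> - 1)) / ((p - 1) p ^ (\<beta> - 1))\<rfloor>\<close>. Substituting \<open>y = F\<^sub>j x\<close> and expanding the
  product over \<open>j\<close> writes the number of zeros as a combination of sums over the box of
  integer-valued polynomials \<open>\<Prod>j. (F\<^sub>j x choose k\<^sub>j)\<close> of degree at most \<open>D = \<Sum>j. k\<^sub>j d\<^sub>j\<close>. Such a
  sum is divisible by \<open>p ^ (N - \<lfloor>D / (p - 1)\<rfloor>)\<close>, because \<open>\<Sum>x<p. (x choose k) = (p choose (k + 1))\<close>
  is divisible by \<open>p\<close> unless \<open>k = p - 1\<close>. A large \<open>k\<^sub>j\<close> is thus paid for by the divisibility of its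
  coefficient.
\<close>

subsection \<open>Finite differences and degrees\<close>

definition pdiff :: "'i \<Rightarrow> (('i \<Rightarrow> nat) \<Rightarrow> int) \<Rightarrow> ('i \<Rightarrow> nat) \<Rightarrow> int"
  where "pdiff i g = (\<lambda>x. g (x(i := Suc (x i))) - g x)"

text \<open>Divisibility by \<open>q = 0\<close> means vanishing, so \<open>deg_le 0\<close> is the exact degree bound.\<close>

primrec deg_le :: "int \<Rightarrow> 'i set \<Rightarrow> nat \<Rightarrow> (('i \<Rightarrow> nat) \<Rightarrow> int) \<Rightarrow> bool" where
  "deg_le q I 0 g = (\<forall>i\<in>I. \<forall>x. q dvd pdiff i g x)"
| "deg_le q I (Suc n) g = (\<forall>i\<in>I. deg_le q I n (pdiff i g))"

lemma deg_le_dvd: "(\<And>x. q dvd g x) \<Longrightarrow> deg_le q I n g"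
  by (induction n arbitrary: g) (auto simp: pdiff_def)

lemma deg_le_const: "deg_le q I n (\<lambda>_. c)"
  by (cases n) (auto simp: pdiff_def intro: deg_le_dvd)

lemma deg_le_Suc: "deg_le q I n g \<Longrightarrow> deg_le q I (Suc n) g"
proof (induction n arbitrary: g)
  case 0
  then have "deg_le q I 0 (pdiff i g)" if "i \<in> I" for i
    using that by (intro deg_le_dvd) auto
  then show ?case
    using deg_le.simps(2) by blast
next
  case (Suc n)
  then show ?case
    using deg_le.simps(2) by blast
qed

lemma deg_le_subset: "deg_le q J n g \<Longrightarrow> I \<subseteq> J \<Longrightarrow> deg_le q I n g"
  by (induction n arbitrary: g) auto

lemma pdiff_add: "pdiff i (\<lambda>x. g x + h x) = (\<lambda>x. pdiff i g x + pdiff i h x)"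
  by (auto simp: pdiff_def)

lemma pdiff_mult:
  "pdiff i (\<lambda>x. g x * h x) = (\<lambda>x. pdiff i g x * h (x(i := Suc (x i))) + g x * pdiff i h x)"
  by (auto simp: pdiff_def algebra_simps)

lemma deg_le_add: "deg_le q I n g \<Longrightarrow> deg_le q I n h \<Longrightarrow> deg_le q I n (\<lambda>x. g x + h x)"
  by (induction n arbitrary: g h) (auto simp: pdiff_add)

lemma deg_le_sum: "(\<And>k. k \<in> K \<Longrightarrow> deg_le q I n (g k)) \<Longrightarrow> deg_le q I n (\<lambda>x. \<Sum>k\<in>K. g k x)"
  by (induction K rule: infinite_finite_induct) (auto intro: deg_le_const deg_le_add)

lemma deg_le_shift:
  assumes "deg_le q I n g" "i \<in> I"
  shows "deg_le q I n (\<lambda>x. g (x(i := Suc (x i))))"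
proof -
  have "deg_le q I n (pdiff i g)"
    using deg_le_Suc[OF assms(1)] assms(2) by simp
  then have "deg_le q I n (\<lambda>x. g x + pdiff i g x)"
    by (rule deg_le_add[OF assms(1)])
  then show ?thesis
    by (simp add: pdiff_def)
qed

lemma deg_le_mult:
  "deg_le q I a g \<Longrightarrow> deg_le q I b h \<Longrightarrow> deg_le q I (a + b) (\<lambda>x. g x * h x)"
proof (induction "a + b" arbitrary: a b g h)
  case 0
  then show ?case
    by (auto simp: pdiff_mult)
next
  case (Suc n)
  have "deg_le q I n (pdiff i (\<lambda>x. g x * h x))" if i: "i \<in> I" for i
    unfolding pdiff_mult
  proof (rule deg_le_add)
    show "deg_le q I n (\<lambda>x. pdiff i g x * h (x(i := Suc (x i))))"
    proof (cases a)
      \<comment> \<open>There is no degree below \<open>0\<close> to pass to, but then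
        \<open>q\<close> divides \<open>pdiff i g\<close>, hence the whole summand.\<close>
      case 0
      with Suc.prems i show ?thesis
        by (auto intro: deg_le_dvd)
    next
      case (Suc a')
      then have "n = a' + b"
        using Suc.hyps(2) by simp
      with Suc show ?thesis
        using Suc.hyps(1)[of a' b "pdiff i g"] Suc.prems i deg_le_shift by fastforce
    qed
    show "deg_le q I n (\<lambda>x. g x * pdiff i h x)"
    proof (cases b)
      case 0
      with Suc.prems i show ?thesis
        by (auto intro: deg_le_dvd)
    next
      case (Suc b')
      then have "n = a + b'"
        using Suc.hyps(2) by simp
      with Suc show ?thesis
        using Suc.hyps(1)[of a b' g "pdiff i h"] Suc.prems i by auto
    qed
  qed
  then show ?case
    unfolding Suc.hyps(2)[symmetric] by simp
qed

lemma deg_le_prod: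
  assumes "finite J" "\<And>j. j \<in> J \<Longrightarrow> deg_le q I (d j) (g j)"
  shows "deg_le q I (\<Sum>j\<in>J. d j) (\<lambda>x. \<Prod>j\<in>J. g j x)"
  using assms by (induction J rule: finite_induct) (auto simp: deg_le_const deg_le_mult simp del: deg_le.simps)

lemma deg_le_cmult_cancel: "c \<noteq> 0 \<Longrightarrow> deg_le 0 I n (\<lambda>x. c * g x) \<Longrightarrow> deg_le 0 I n g"
proof (induction n arbitrary: g)
  case 0
  then show ?case
    by (auto simp: pdiff_def)
next
  case (Suc n)
  have "pdiff i (\<lambda>x. c * g x) = (\<lambda>x. c * pdiff i g x)" for i
    by (auto simp: pdiff_def algebra_simps)
  with Suc show ?case
    by auto
qed

lemma Suc_times_binomial_int:
  "(1 + int k) * int (n choose Suc k) = int (n choose k) * (int n - int k)"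
proof (cases "k \<le> n")
  case True
  have "Suc k * (n choose Suc k) = (n choose k) * (n - k)"
    by (metis binomial_absorption binomial_absorb_comp mult.commute)
  then have "int (Suc k * (n choose Suc k)) = int ((n choose k) * (n - k))"
    by simp
  with True show ?thesis
    by (simp add: of_nat_diff algebra_simps)
qed (simp add: binomial_eq_0)

text \<open>Multiplying by \<open>k!\<close> turns the binomial coefficient into a product of \<open>k\<close> factors, and
  exact degrees (modulus \<open>0\<close>) do not change under multiplication by a nonzero constant.\<close>

lemma deg_le_binomial:
  assumes "deg_le 0 I d (\<lambda>x. int (F x))"
  shows "deg_le 0 I (k * d) (\<lambda>x. int (F x choose k))"
proof (induction k)
  case 0
  show ?case
    by (simp add: pdiff_def)
next
  case (Suc k)
  have "deg_le 0 I d (\<lambda>x. int (F x) + - int k)"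
    by (intro deg_le_add assms deg_le_const)
  from deg_le_mult[OF Suc this]
  have "deg_le 0 I (k * d + d) (\<lambda>x. (1 + int k) * int (F x choose Suc k))"
    by (simp add: Suc_times_binomial_int)
  then have "deg_le 0 I (k * d + d) (\<lambda>x. int (F x choose Suc k))"
    by (rule deg_le_cmult_cancel[rotated]) simp
  then show ?case
    by (simp only: mult_Suc add.commute)
qed

lemma deg_le_coordinate: "deg_le q I 1 (\<lambda>x. int (x i))"
  by (auto simp: pdiff_def)

text \<open>Fixing coordinate \<open>a\<close> removes all dependence on it. Newton coefficients in
  direction \<open>a\<close> thus keep their degree bound on the larger index set.\<close>

lemma deg_le_upd:
  assumes "deg_le q I n g" "a \<notin> I"
  shows "deg_le q (insert a I) n (\<lambda>x. g (x(a := t)))"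
proof -
  have a: "pdiff a (\<lambda>x. h (x(a := t))) = (\<lambda>x. 0)" for h :: "('a \<Rightarrow> nat) \<Rightarrow> int"
    by (simp add: pdiff_def)
  have i: "pdiff i (\<lambda>x. h (x(a := t))) = (\<lambda>x. pdiff i h (x(a := t)))" if "i \<in> I"
    for i and h :: "('a \<Rightarrow> nat) \<Rightarrow> int"
  proof -
    have "i \<noteq> a"
      using that assms(2) by blast
    then show ?thesis
      by (simp add: pdiff_def fun_upd_twist[of i a])
  qed
  show ?thesis
    using assms(1) by (induction n arbitrary: g) (auto simp: a i deg_le_const)
qed

lemma deg_le_pdiff_power:
  "deg_le q I (n + k) g \<Longrightarrow> a \<in> I \<Longrightarrow> deg_le q I n ((pdiff a ^^ k) g)"
  by (induction k arbitrary: g) (auto simp: funpow_Suc_right simp del: funpow.simps)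

text \<open>After \<open>n\<close> differences only a constant modulo \<open>q\<close> remains, so
  all further differences vanish modulo \<open>q\<close>. This truncates Newton series.\<close>

lemma pdiff_power_dvd:
  assumes "deg_le q I n g" "a \<in> I" "n < k"
  shows "q dvd (pdiff a ^^ k) g x"
proof -
  have "deg_le q I 0 ((pdiff a ^^ n) g)"
    using assms deg_le_pdiff_power[of q I 0 n g a] by simp
  then have 1: "q dvd (pdiff a ^^ Suc n) g x" for x
    using assms(2) by simp
  have "q dvd (pdiff a ^^ (m + Suc n)) g x" for m x
  proof (induction m arbitrary: x)
    case 0
    show ?case using 1[of x] by simp
  next
    case (Suc m)
    let ?h = "(pdiff a ^^ (m + Suc n)) g"
    have "(pdiff a ^^ (Suc m + Suc n)) g x = ?h (x(a := Suc (x a))) - ?h x"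
      unfolding add_Suc funpow.simps comp_apply pdiff_def[of a "(pdiff a ^^ (m + Suc n)) g"] ..
    then show ?case
      using Suc by (metis dvd_diff)
  qed
  from this[of "k - Suc n"] assms(3) show ?thesis
    by simp
qed

section \<open>Newton series in one coordinate, and sums over the box\<close>

lemma newton_expansion:
  "g (x(a := n)) = (\<Sum>k\<le>n. int (n choose k) * (pdiff a ^^ k) g (x(a := 0)))"
proof (induction n arbitrary: g)
  case 0
  then show ?case by simp
next
  case (Suc n)
  let ?D = "\<lambda>k. (pdiff a ^^ k) g (x(a := 0))"
  have "g (x(a := Suc n)) = g (x(a := n)) + pdiff a g (x(a := n))"
    by (simp add: pdiff_def)
  also have "\<dots> = (\<Sum>k\<le>n. int (n choose k) * ?D k) + (\<Sum>k\<le>n. int (n choose k) * ?D (Suc k))"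
    unfolding Suc[of g] Suc[of "pdiff a g"] funpow_Suc_right comp_apply ..
  also have "(\<Sum>k\<le>n. int (n choose k) * ?D k) = (\<Sum>k\<le>Suc n. int (n choose k) * ?D k)"
    by simp
  also have "\<dots> = ?D 0 + (\<Sum>k\<le>n. int (n choose Suc k) * ?D (Suc k))"
    by (subst sum.atMost_Suc_shift) simp
  also have "\<dots> + (\<Sum>k\<le>n. int (n choose k) * ?D (Suc k))
      = (\<Sum>k\<le>Suc n. int (Suc n choose k) * ?D k)"
    by (simp add: sum.atMost_Suc_shift sum.distrib algebra_simps del: sum.atMost_Suc funpow.simps)
  finally show ?case .
qed

lemma newton_expansion_lessThan:
  assumes "n < m"
  shows "g (x(a := n)) = (\<Sum>k<m. int (n choose k) * (pdiff a ^^ k) g (x(a := 0)))"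
  unfolding newton_expansion[of g x a n]
  by (rule sum.mono_neutral_left) (use assms in auto)

lemma sum_newton_expansion:
  "(\<Sum>t<n. g (x(a := t))) = (\<Sum>k<n. int (n choose Suc k) * (pdiff a ^^ k) g (x(a := 0)))"
proof -
  have "(\<Sum>t<n. g (x(a := t)))
      = (\<Sum>t<n. \<Sum>k<n. int (t choose k) * (pdiff a ^^ k) g (x(a := 0)))"
    by (intro sum.cong refl newton_expansion_lessThan) simp
  also have "\<dots> = (\<Sum>k<n. \<Sum>t<n. int (t choose k) * (pdiff a ^^ k) g (x(a := 0)))"
    by (rule sum.swap)
  also have "\<dots> = (\<Sum>k<n. int (n choose Suc k) * (pdiff a ^^ k) g (x(a := 0)))"
  proof (rule sum.cong[OF refl])
    fix k
    have "(\<Sum>t<n. t choose k) = n choose Suc k"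
      by (induction n) auto
    then show "(\<Sum>t<n. int (t choose k) * (pdiff a ^^ k) g (x(a := 0)))
        = int (n choose Suc k) * (pdiff a ^^ k) g (x(a := 0))"
      by (simp flip: sum_distrib_right of_nat_sum)
  qed
  finally show ?thesis .
qed

lemma sum_PiE_insert:
  assumes "a \<notin> I"
  shows "(\<Sum>x\<in>PiE (insert a I) S. g x) = (\<Sum>x\<in>PiE I S. \<Sum>t\<in>S a. g (x(a := t)))"
proof -
  have "(\<Sum>x\<in>PiE (insert a I) S. g x) = (\<Sum>(t, x)\<in>S a \<times> PiE I S. g (x(a := t)))"
    unfolding PiE_insert_eq using inj_combinator[OF assms]
    by (subst sum.reindex) (auto simp: case_prod_unfold)
  also have "\<dots> = (\<Sum>t\<in>S a. \<Sum>x\<in>PiE I S. g (x(a := t)))"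
    by (rule sum.cartesian_product[symmetric])
  also have "\<dots> = (\<Sum>x\<in>PiE I S. \<Sum>t\<in>S a. g (x(a := t)))"
    by (rule sum.swap)
  finally show ?thesis .
qed

text \<open>Coordinates are summed out one at a time. Each either yields a factor \<open>p\<close>
  from \<open>p choose Suc k\<close> or, for \<open>k = p - 1\<close>, uses up \<open>p - 1\<close>
  of the degree, which can happen at most \<open>D div (p - 1)\<close> times.\<close>

lemma dvd_sum_box:
  assumes p: "prime p" and "finite I" and "deg_le 0 I D g"
  shows "int p ^ (card I - D div (p - 1)) dvd (\<Sum>x\<in>PiE I (\<lambda>_. {..<p}). g x)"
  using assms(2,3)
proof (induction I arbitrary: D g rule: finite_induct)
  case empty
  then show ?case by simp
next
  case (insert a I)
  let ?S = "\<lambda>_. {..<p}"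
  let ?h = "\<lambda>k x. (pdiff a ^^ k) g (x(a := 0))"
  have p1: "p - 1 > 0"
    using prime_gt_1_nat[OF p] by simp
  have "(\<Sum>x\<in>PiE (insert a I) ?S. g x) = (\<Sum>x\<in>PiE I ?S. \<Sum>k<p. int (p choose Suc k) * ?h k x)"
    by (simp add: sum_PiE_insert[OF insert.hyps(2)] sum_newton_expansion)
  also have "\<dots> = (\<Sum>k<p. int (p choose Suc k) * (\<Sum>x\<in>PiE I ?S. ?h k x))"
    by (subst sum.swap) (simp add: sum_distrib_left)
  also have "int p ^ (card (insert a I) - D div (p - 1)) dvd \<dots>"
  proof (rule dvd_sum)
    fix k assume "k \<in> {..<p}"
    then have k: "k < p" by simp
    show "int p ^ (card (insert a I) - D div (p - 1)) dvd
      int (p choose Suc k) * (\<Sum>x\<in>PiE I ?S. ?h k x)"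
    proof (cases "k \<le> D")
      case False
      then have "?h k x = 0" for x
        using pdiff_power_dvd[OF insert.prems, of a k "x(a := 0)"] by simp
      then show ?thesis by simp
    next
      case True
      have "deg_le 0 I (D - k) ((pdiff a ^^ k) g)"
        using deg_le_pdiff_power[of 0 "insert a I" "D - k" k g a] insert.prems True
        by (auto intro: deg_le_subset)
      then have "deg_le 0 I (D - k) (?h k)"
        using insert.hyps(2) by (auto intro: deg_le_subset[OF deg_le_upd])
      note IH = insert.IH[OF this]
      show ?thesis
      proof (cases "Suc k = p")
        \<comment> \<open>Here \<open>p choose p = 1\<close> gives no factor \<open>p\<close>, but
          the quotient of the degree by \<open>p - 1\<close> drops by one, which pays for the
          coordinate \<open>a\<close>.\<close>
        case True
        then have "(D - k) div (p - 1) = D div (p - 1) - 1" "D div (p - 1) \<ge> 1"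
          using p1 \<open>k \<le> D\<close> by (auto simp: le_div_geq)
        then have "card I - (D - k) div (p - 1) \<ge> card (insert a I) - D div (p - 1)"
          using insert.hyps by simp
        then show ?thesis
          using IH by (meson dvd_mult dvd_trans le_imp_power_dvd)
      next
        case False
        have "int p dvd int (p choose Suc k)"
          using False k p by (auto intro!: dvd_choose_prime)
        then have *: "int p ^ Suc (card I - (D - k) div (p - 1)) dvd
            int (p choose Suc k) * (\<Sum>x\<in>PiE I ?S. ?h k x)"
          unfolding power_Suc using IH by (intro mult_dvd_mono)
        have "(D - k) div (p - 1) \<le> D div (p - 1)"
          by (intro div_le_mono) simp
        then have "card (insert a I) - D div (p - 1) \<le> Suc (card I - (D - k) div (p - 1))"
          using insert.hyps by simp
        then show ?thesis
          using * by (meson dvd_trans le_imp_power_dvd)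
      qed
    qed
  qed
  finally show ?case .
qed

text \<open>The lift is the Newton series whose coefficients are the least nonnegative residues of
  those of \<open>g\<close>, with the coefficients of degree above \<open>d\<close> dropped.\<close>

lemma deg_le_lift:
  assumes "q > 0" "finite I" "deg_le q I d g"
  shows "\<exists>G. deg_le 0 I d (\<lambda>x. int (G x)) \<and>
    (\<forall>x\<in>PiE I (\<lambda>_. {..<m}). q dvd int (G x) - g x)"
  using assms(2,3)
proof (induction I arbitrary: d g rule: finite_induct)
  case empty
  then show ?case
    \<comment> \<open>Without coordinates every degree bound is vacuous, so the residue of
      \<open>g\<close> itself is a lift.\<close>
    using assms(1) by (intro exI[of _ "\<lambda>x. nat (g x mod q)"]) (cases d; auto simp: mod_eq_dvd_iff[symmetric])
next
  case (insert a I)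
  let ?S = "\<lambda>_. {..<m}"
  let ?h = "\<lambda>k x. (pdiff a ^^ k) g (x(a := 0))"
  have "\<exists>H. deg_le 0 I (d - k) (\<lambda>x. int (H x)) \<and> (\<forall>x\<in>PiE I ?S. q dvd int (H x) - ?h k x)"
    if "k \<le> d" for k
  proof -
    have "deg_le q I (d - k) ((pdiff a ^^ k) g)"
      using deg_le_pdiff_power[of q "insert a I" "d - k" k g a] insert.prems that
      by (auto intro: deg_le_subset)
    then have "deg_le q I (d - k) (?h k)"
      using insert.hyps(2) by (auto intro: deg_le_subset[OF deg_le_upd])
    then show ?thesis
      by (rule insert.IH)
  qed
  then obtain H where H: "\<And>k. k \<le> d \<Longrightarrow> deg_le 0 I (d - k) (\<lambda>x. int (H k x))"
      "\<And>k x. k \<le> d \<Longrightarrow> x \<in> PiE I ?S \<Longrightarrow> q dvd int (H k x) - ?h k x"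
    by metis
  \<comment> \<open>Resetting \<open>a\<close> to \<open>undefined\<close> moves a point of the box
    over \<open>insert a I\<close> into the box over \<open>I\<close>, where \<open>H k\<close>
    approximates the Newton coefficient.\<close>
  define G where "G x = (\<Sum>k\<in>{..<m} \<inter> {..d}. (x a choose k) * H k (x(a := undefined)))" for x
  have "deg_le 0 (insert a I) (k + (d - k)) (\<lambda>x. int (x a choose k) * int (H k (x(a := undefined))))"
    if "k \<le> d" for k
    using deg_le_binomial[OF deg_le_coordinate, of "insert a I" k a] deg_le_upd[OF H(1)[OF that] insert.hyps(2)]
    by (intro deg_le_mult) auto
  then have "deg_le 0 (insert a I) d (\<lambda>x. int (G x))"
    unfolding G_def of_nat_sum of_nat_mult by (intro deg_le_sum) auto
  moreover have "q dvd int (G x) - g x" if x: "x \<in> PiE (insert a I) ?S" for x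
  proof -
    let ?y = "x(a := undefined)"
    have y: "?y \<in> PiE I ?S" and xa: "x a < m"
      using x insert.hyps(2) by (auto simp: PiE_iff extensional_def)
    have large: "q dvd ?h k ?y" if "\<not> k \<le> d" for k
      using pdiff_power_dvd[OF insert.prems] that by simp
    have "g x = (\<Sum>k<m. int (x a choose k) * ?h k ?y)"
      using newton_expansion_lessThan[OF xa, of g ?y a] by simp
    also have "\<dots> = (\<Sum>k\<in>{..<m} \<inter> {..d}. int (x a choose k) * ?h k ?y)
        + (\<Sum>k\<in>{..<m} - {..d}. int (x a choose k) * ?h k ?y)"
      by (subst sum.Int_Diff[of _ _ "{..d}"]) auto
    finally have "int (G x) - g x
        = (\<Sum>k\<in>{..<m} \<inter> {..d}. int (x a choose k) * (int (H k ?y) - ?h k ?y))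
        - (\<Sum>k\<in>{..<m} - {..d}. int (x a choose k) * ?h k ?y)"
      by (simp add: G_def algebra_simps sum_subtractf)
    also have "q dvd \<dots>"
      using H(2)[OF _ y] large
      by (intro dvd_diff dvd_sum) (rule dvd_mult, simp)+
    finally show ?thesis .
  qed
  ultimately show ?case by blast
qed

subsection \<open>Weisman's congruence\<close>

text \<open>The linear functional taking \<open>X^n\<close> to the indicator of \<open>q\<close>
  dividing \<open>n\<close>. For \<open>q > 0\<close> it averages \<open>P\<close> over the complex
  \<open>q\<close>-th roots of unity.\<close>

definition coeff_sum_mult :: "nat \<Rightarrow> int poly \<Rightarrow> int"
  where "coeff_sum_mult q P = (\<Sum>i | i \<le> degree P \<and> q dvd i. coeff P i)"

lemma coeff_sum_mult_eq:
  assumes "degree P \<le> n"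
  shows "coeff_sum_mult q P = (\<Sum>i | i \<le> n \<and> q dvd i. coeff P i)"
  unfolding coeff_sum_mult_def
  by (rule sum.mono_neutral_left) (use assms in \<open>auto intro: le_degree\<close>)

lemma coeff_sum_mult_add:
  "coeff_sum_mult q (P + Q) = coeff_sum_mult q P + coeff_sum_mult q Q"
proof -
  define n where "n = max (degree P) (degree Q)"
  have "degree P \<le> n" "degree Q \<le> n" "degree (P + Q) \<le> n"
    by (auto simp: n_def degree_add_le)
  then show ?thesis
    by (simp add: coeff_sum_mult_eq sum.distrib)
qed

lemma coeff_sum_mult_smult: "coeff_sum_mult q (smult c P) = c * coeff_sum_mult q P"
  using coeff_sum_mult_eq[OF degree_smult_le[of c P], of q]
  by (simp add: coeff_sum_mult_def sum_distrib_left)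

lemma coeff_sum_mult_sum:
  "coeff_sum_mult q (\<Sum>k\<in>K. P k) = (\<Sum>k\<in>K. coeff_sum_mult q (P k))"
proof (induction K rule: infinite_finite_induct)
  case (insert k K)
  then show ?case by (simp add: coeff_sum_mult_add)
qed (simp_all add: coeff_sum_mult_def)

lemma coeff_sum_mult_monom: "coeff_sum_mult q (monom 1 n) = (if q dvd n then 1 else 0)"
proof -
  have "(\<Sum>i | i \<le> n \<and> q dvd i. coeff (monom 1 n) i) = (\<Sum>i\<in>{i. i \<le> n \<and> q dvd i}. if i = n then 1 else 0 :: int)"
    by (rule sum.cong) auto
  also have "\<dots> = (if q dvd n then 1 else 0)"
    by (subst sum.delta) auto
  finally show ?thesis
    by (simp add: coeff_sum_mult_eq[of _ n] degree_monom_eq)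
qed

text \<open>Adding \<open>q\<close> to an exponent preserves divisibility by \<open>q\<close>. Hence
  the functional kills all multiples of \<open>X^q - 1\<close>.\<close>

lemma coeff_sum_mult_shift: "coeff_sum_mult q (monom 1 q * P) = coeff_sum_mult q P"
proof -
  have P: "P = (\<Sum>i\<le>degree P. smult (coeff P i) (monom 1 i))"
    by (simp add: smult_monom poly_as_sum_of_monoms)
  have "monom 1 q * P = (\<Sum>i\<le>degree P. smult (coeff P i) (monom 1 (q + i)))"
    by (subst P) (simp add: sum_distrib_left mult_monom smult_monom)
  then have "coeff_sum_mult q (monom 1 q * P)
      = (\<Sum>i\<le>degree P. coeff P i * coeff_sum_mult q (monom 1 (q + i)))"
    by (simp only: coeff_sum_mult_sum coeff_sum_mult_smult)
  also have "\<dots> = (\<Sum>i\<le>degree P. coeff P i * coeff_sum_mult q (monom 1 i))"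
    by (simp add: coeff_sum_mult_monom)
  also have "\<dots> = coeff_sum_mult q P"
    by (subst (2) P) (simp only: coeff_sum_mult_sum coeff_sum_mult_smult)
  finally show ?thesis .
qed

text \<open>The \<open>k\<close>-th forward difference at \<open>0\<close> of the indicator of the
  multiples of \<open>q\<close>, that is, Fleck's sum of \<open>(-1)^(k - i) * (k choose i)\<close>
  over \<open>i\<close> divisible by \<open>q\<close>.\<close>

definition newton_coeff :: "nat \<Rightarrow> nat \<Rightarrow> int"
  where "newton_coeff q k = coeff_sum_mult q ((monom 1 1 - 1) ^ k)"

text \<open>The functional is applied to \<open>X^n = ((X - 1) + 1)^n\<close>. A bound
  \<open>K\<close> independent of \<open>n\<close> lets all points share one range of
  summation.\<close>

lemma dvd_indicator_eq_sum:
  assumes "n \<le> K"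
  shows "(if q dvd n then 1 else 0) = (\<Sum>k\<le>K. newton_coeff q k * int (n choose k))"
proof -
  have "monom 1 n = ((monom 1 1 - 1) + 1 :: int poly) ^ n"
    by (simp add: monom_power)
  also have "\<dots> = (\<Sum>k\<le>n. smult (int (n choose k)) ((monom 1 1 - 1) ^ k))"
    by (subst binomial_ring) (simp add: of_nat_poly)
  finally have "coeff_sum_mult q (monom 1 n) = (\<Sum>k\<le>n. int (n choose k) * newton_coeff q k)"
    by (simp only: coeff_sum_mult_sum coeff_sum_mult_smult newton_coeff_def)
  also have "\<dots> = (\<Sum>k\<le>K. newton_coeff q k * int (n choose k))"
    by (rule sum.mono_neutral_cong_left) (use assms in auto)
  finally show ?thesis
    by (simp add: coeff_sum_mult_monom)
qed

text \<open>Expanding \<open>((u - 1) + 1)^p\<close> instead of \<open>(u - 1)^p\<close> avoids the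
  sign \<open>(-1)^p\<close>, so \<open>p = 2\<close> is not special.\<close>

lemma freshman_diff_one:
  fixes u :: "'a :: comm_ring_1"
  assumes "prime p"
  shows "of_nat p dvd (u - 1) ^ p - (u ^ p - 1)"
proof -
  have p: "p > 0"
    using prime_gt_0_nat[OF assms] .
  have "u ^ p = ((u - 1) + 1) ^ p"
    by simp
  also have "\<dots> = (\<Sum>k\<le>p. of_nat (p choose k) * (u - 1) ^ k)"
    by (subst binomial_ring) simp
  also have "{..p} = insert 0 (insert p {1..<p})"
    using p by auto
  also have "(\<Sum>k\<in>\<dots>. of_nat (p choose k) * (u - 1) ^ k)
      = 1 + ((u - 1) ^ p + (\<Sum>k=1..<p. of_nat (p choose k) * (u - 1) ^ k))"
    using p by simp
  finally have "(u - 1) ^ p - (u ^ p - 1) = - (\<Sum>k=1..<p. of_nat (p choose k) * (u - 1) ^ k)"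
    by simp
  also have "of_nat p dvd \<dots>"
    unfolding dvd_minus_iff
  proof (intro dvd_sum dvd_mult2)
    fix k assume "k \<in> {1..<p}"
    then have "p dvd (p choose k)"
      by (intro dvd_choose_prime) (use assms in auto)
    then show "of_nat p dvd (of_nat (p choose k) :: 'a)"
      by (metis dvdE dvd_triv_left of_nat_mult)
  qed
  finally show ?thesis .
qed

lemma freshman_diff_one_power:
  fixes u :: "'a :: comm_ring_1"
  assumes "prime p"
  shows "of_nat p dvd (u - 1) ^ (p ^ n) - (u ^ (p ^ n) - 1)"
proof (induction n)
  case (Suc n)
  let ?a = "(u - 1) ^ (p ^ n)" and ?b = "u ^ (p ^ n)"
  have "?a - (?b - 1) dvd ?a ^ p - (?b - 1) ^ p"
    by (simp add: power_diff_sumr2)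
  with Suc have "of_nat p dvd ?a ^ p - (?b - 1) ^ p"
    by (rule dvd_trans)
  from dvd_add[OF this freshman_diff_one[OF assms, of ?b]]
  show ?case
    by (simp add: power_mult[symmetric] mult.commute diff_diff_eq2 add_diff_eq)
qed simp

text \<open>Weisman's extension of Fleck's congruence. Modulo \<open>X ^ q - 1\<close>, where
  \<open>q = p ^ Suc b\<close>, the element \<open>X ^ (q div p) - 1\<close> is annihilated by the cyclotomic polynomial
  \<open>\<Phi>\<^sub>q\<close>, which is congruent to \<open>(X - 1) ^ totient q\<close> modulo \<open>p\<close>.\<close>

lemma weisman_poly:
  fixes p b i k :: nat
  assumes p: "prime p" and k: "k \<ge> p ^ b + i * ((p - 1) * p ^ b)"
  defines "E \<equiv> monom 1 1 :: int poly"
  shows "\<exists>U V. (E - 1) ^ k = of_nat (p ^ i) * U + (E ^ (p ^ Suc b) - 1) * V"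
  using k
proof (induction i arbitrary: k)
  case 0
  show ?case
    by (rule exI[of _ "(E - 1) ^ k"], rule exI[of _ 0]) simp
next
  case (Suc i)
  \<comment> \<open>With \<open>q = p ^ Suc b\<close>, \<open>t\<close> is the totient of
    \<open>q\<close>, \<open>y\<close> is \<open>X^(q/p)\<close>, and \<open>\<Phi>\<close> is the
    \<open>q\<close>-th cyclotomic polynomial.\<close>
  define t where "t = (p - 1) * p ^ b"
  define y where "y = E ^ (p ^ b)"
  define \<Phi> where "\<Phi> = (\<Sum>j<p. y ^ j)"
  have pb: "p ^ b + t = p ^ Suc b"
    using prime_gt_0_nat[OF p] by (cases p) (auto simp: t_def)
  have tge: "t \<ge> p ^ b"
    using prime_gt_1_nat[OF p] by (simp add: t_def)
  have yp: "y ^ p = E ^ (p ^ Suc b)"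
    by (simp add: y_def power_mult[symmetric] mult.commute)
  have \<Phi>: "(y - 1) * \<Phi> = E ^ (p ^ Suc b) - 1"
    unfolding \<Phi>_def yp[symmetric] by (simp add: power_diff_1_eq)
  obtain h where h: "(E - 1) ^ (p ^ b) = (y - 1) + of_nat p * h"
    using freshman_diff_one_power[OF p, of E b] unfolding y_def
    by (metis dvdE diff_add_cancel add.commute)
  \<comment> \<open>Multiplied by \<open>(E - 1) ^ (p ^ b)\<close>, both \<open>(E - 1) ^ t\<close>
    and \<open>\<Phi>\<close> become \<open>X^q - 1\<close> modulo \<open>p\<close>. The multiplier
    then cancels, as \<open>p\<close> is prime in the polynomial ring and does not divide
    it.\<close>
  have "of_nat p dvd (E - 1) ^ (p ^ b) * ((E - 1) ^ t - \<Phi>)"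
  proof -
    have "(E - 1) ^ (p ^ b) * ((E - 1) ^ t - \<Phi>)
        = ((E - 1) ^ (p ^ Suc b) - (E ^ (p ^ Suc b) - 1)) - of_nat p * h * \<Phi>"
      unfolding pb[symmetric] power_add \<Phi>[unfolded pb[symmetric] power_add, symmetric] 
      by (simp add: h algebra_simps)
    also have "of_nat p dvd \<dots>"
      by (intro dvd_diff freshman_diff_one_power p) (simp add: mult.assoc)
    finally show ?thesis .
  qed
  moreover have "prime_elem (of_nat p :: int poly)"
    using p by (simp add: of_nat_poly prime_elem_const_poly_iff)
  moreover have "\<not> of_nat p dvd (E - 1) ^ (p ^ b)"
  proof
    assume "of_nat p dvd (E - 1) ^ (p ^ b)"
    then have "of_nat p dvd E - 1"
      using \<open>prime_elem _\<close> prime_elem_dvd_power by blast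
    then have "[:int p:] dvd E - 1"
      by (simp add: of_nat_poly)
    then have "int p dvd coeff (E - 1) 1"
      by (simp only: const_poly_dvd_iff)
    then show False
      using prime_gt_1_nat[OF p] by (simp add: E_def)
  qed
  ultimately have "of_nat p dvd (E - 1) ^ t - \<Phi>"
    by (simp add: prime_elem_dvd_mult_iff)
  then obtain g where g: "(E - 1) ^ t = \<Phi> + of_nat p * g"
    by (metis dvdE diff_add_cancel add.commute)
  \<comment> \<open>Modulo \<open>X^q - 1\<close>, each factor \<open>(E - 1) ^ t\<close> acts on
    multiples of \<open>y - 1\<close> as \<open>p * g\<close>, because
    \<open>(y - 1) * \<Phi>\<close> vanishes there.\<close>
  have *: "\<exists>V. (E - 1) ^ (n * t) * (y - 1) = of_nat (p ^ n) * (g ^ n * (y - 1)) + (E ^ (p ^ Suc b) - 1) * V" for n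
  proof (induction n)
    case 0
    show ?case by (intro exI[of _ 0]) simp
  next
    case (Suc n)
    then obtain V where V: "(E - 1) ^ (n * t) * (y - 1) = of_nat (p ^ n) * (g ^ n * (y - 1)) + (E ^ (p ^ Suc b) - 1) * V"
      by blast
    have "(E - 1) ^ (Suc n * t) * (y - 1) = (E - 1) ^ t * ((E - 1) ^ (n * t) * (y - 1))"
      by (simp add: power_add)
    also have "\<dots> = (\<Phi> + of_nat p * g) * (of_nat (p ^ n) * (g ^ n * (y - 1))) + (E ^ (p ^ Suc b) - 1) * (V * (E - 1) ^ t)"
      unfolding V by (simp add: g algebra_simps)
    also have "\<dots> = of_nat (p ^ Suc n) * (g ^ Suc n * (y - 1)) + (E ^ (p ^ Suc b) - 1) * (of_nat (p ^ n) * g ^ n + V * (E - 1) ^ t)"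
      unfolding \<Phi>[symmetric] by (simp add: algebra_simps)
    finally show ?case by blast
  qed
  obtain V1 where V1: "(E - 1) ^ (Suc i * t) * (y - 1)
      = of_nat (p ^ Suc i) * (g ^ Suc i * (y - 1)) + (E ^ (p ^ Suc b) - 1) * V1"
    using * by blast
  \<comment> \<open>One factor \<open>(E - 1) ^ (p ^ b)\<close> will be split as
    \<open>(y - 1) + p * h\<close>. The first part gains \<open>p ^ Suc i\<close> by
    \<open>*\<close>; the second already carries one \<open>p\<close>, so the induction hypothesis
    at exponent \<open>Suc i * t\<close> suffices.\<close>
  have "Suc i * t \<ge> p ^ b + i * ((p - 1) * p ^ b)"
    using tge by (simp add: t_def)
  from Suc.IH[OF this] obtain U2 V2 where
    V2: "(E - 1) ^ (Suc i * t) = of_nat (p ^ i) * U2 + (E ^ (p ^ Suc b) - 1) * V2"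
    by blast
  define l where "l = k - (p ^ b + Suc i * t)"
  have kl: "k = l + (Suc i * t + p ^ b)"
    using Suc.prems by (simp add: l_def t_def)
  have "(E - 1) ^ k = (E - 1) ^ l * ((E - 1) ^ (Suc i * t) * (y - 1) + of_nat p * h * (E - 1) ^ (Suc i * t))"
    unfolding kl power_add[of _ l] power_add[of _ "Suc i * t"] h by (simp add: algebra_simps)
  also have "\<dots> = of_nat (p ^ Suc i) * ((E - 1) ^ l * (g ^ Suc i * (y - 1) + h * U2))
      + (E ^ (p ^ Suc b) - 1) * ((E - 1) ^ l * (V1 + of_nat p * h * V2))"
    unfolding V1 unfolding V2 by (simp add: algebra_simps)
  finally show ?case
    by blast
qed

text \<open>The functional kills the multiple of \<open>X^q - 1\<close> from
  \<open>weisman_poly\<close>, with \<open>q = p ^ b\<close>, and leaves the power of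
  \<open>p\<close>. For \<open>k < p ^ (b - 1)\<close> truncated subtraction makes the exponent
  \<open>0\<close>.\<close>

lemma weisman:
  assumes "prime p" "b \<ge> 1"
  shows "int p ^ ((k - p ^ (b - 1)) div ((p - 1) * p ^ (b - 1))) dvd newton_coeff (p ^ b) k"
proof (cases "k \<ge> p ^ (b - 1)")
  case True
  let ?i = "(k - p ^ (b - 1)) div ((p - 1) * p ^ (b - 1))"
  let ?E = "monom 1 1 :: int poly"
  obtain c where c: "b = Suc c"
    using assms(2) by (cases b) auto
  have "?i * ((p - 1) * p ^ c) \<le> k - p ^ c"
    unfolding c diff_Suc_1 by (rule div_times_less_eq_dividend)
  then have "k \<ge> p ^ c + ?i * ((p - 1) * p ^ c)"
    using True unfolding c diff_Suc_1 by linarith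
  from weisman_poly[OF assms(1) this] obtain U V where
    "(?E - 1) ^ k = of_nat (p ^ ?i) * U + (?E ^ (p ^ b) - 1) * V"
    unfolding c by blast
  also have "\<dots> = smult (int p ^ ?i) U + (monom 1 (p ^ b) * V + smult (-1) V)"
    by (simp add: of_nat_poly monom_power algebra_simps)
  finally have "newton_coeff (p ^ b) k = int p ^ ?i * coeff_sum_mult (p ^ b) U"
    unfolding newton_coeff_def
    by (simp only: coeff_sum_mult_add coeff_sum_mult_smult coeff_sum_mult_shift)
  then show ?thesis by simp
qed simp

subsection \<open>Counting zeros\<close>

lemma power_pred_sum: "(p - 1) * (\<Sum>i<b. p ^ i) = p ^ b - (1::nat)"
proof (cases "p = 0")
  case False
  then have "int ((p - 1) * (\<Sum>i<b. p ^ i)) = int (p ^ b - 1)"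
    using power_diff_1_eq[of "int p" b] by (simp add: of_nat_diff)
  then show ?thesis
    by (simp only: of_nat_eq_iff)
qed (cases b; simp)

text \<open>Assumption \<open>m\<close> says without division that \<open>m\<close> is at most the
  ceiling of \<open>(card I - S) / M\<close>, with \<open>S\<close> as defined in the proof. The
  guard \<open>m \<ge> 1\<close> keeps \<open>m - 1\<close> from being truncated.\<close>

lemma dvd_card_zeros:
  fixes F :: "'j \<Rightarrow> ('i \<Rightarrow> nat) \<Rightarrow> nat"
  assumes p: "prime p" and fin: "finite I" "finite J"
    and b: "\<And>j. j \<in> J \<Longrightarrow> b j \<ge> 1"
    and F: "\<And>j. j \<in> J \<Longrightarrow> deg_le 0 I (d j) (\<lambda>x. int (F j x))"
    and M: "\<And>j. j \<in> J \<Longrightarrow> p ^ (b j - 1) * d j \<le> M" and "M \<ge> 1"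
    and m: "m \<ge> 1 \<Longrightarrow> (\<Sum>j\<in>J. (\<Sum>i<b j. p ^ i) * d j) + (m - 1) * M < card I"
  shows "p ^ m dvd card {x \<in> PiE I (\<lambda>_. {..<p}). \<forall>j\<in>J. p ^ b j dvd F j x}"
proof -
  let ?X = "PiE I (\<lambda>_. {..<p})"
  define s where "s j = (\<Sum>i<b j. p ^ i)" for j
  define S where "S = (\<Sum>j\<in>J. s j * d j)"
  have finX: "finite ?X"
    using fin by (intro finite_PiE) auto
  \<comment> \<open>A common bound gives all Newton series the same range; \<open>insert 0\<close>
    keeps \<open>Max\<close> meaningful if there are no values.\<close>
  define K where "K = Max (insert 0 ((\<lambda>(j, x). F j x) ` (J \<times> ?X)))"
  have K: "F j x \<le> K" if "j \<in> J" "x \<in> ?X" for j x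
    unfolding K_def by (rule Max_ge) (use that finX fin in auto)
  let ?c = "\<lambda>j k. newton_coeff (p ^ b j) k"
  have "int (card {x \<in> ?X. \<forall>j\<in>J. p ^ b j dvd F j x})
      = (\<Sum>x\<in>?X. if \<forall>j\<in>J. p ^ b j dvd F j x then 1 else 0)"
    using finX by (simp add: sum.If_cases Int_def)
  also have "\<dots> = (\<Sum>x\<in>?X. \<Prod>j\<in>J. if p ^ b j dvd F j x then 1 else 0)"
  proof (rule sum.cong[OF refl])
    fix x
    show "(if \<forall>j\<in>J. p ^ b j dvd F j x then 1 else 0) = (\<Prod>j\<in>J. if p ^ b j dvd F j x then 1 else (0 :: int))"
      using fin(2) by (auto simp: prod_zero_iff)
  qed
  also have "\<dots> = (\<Sum>x\<in>?X. \<Prod>j\<in>J. \<Sum>k\<le>K. ?c j k * int (F j x choose k))"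
    by (intro sum.cong prod.cong refl dvd_indicator_eq_sum K)
  also have "\<dots> = (\<Sum>x\<in>?X. \<Sum>\<kappa>\<in>PiE J (\<lambda>_. {..K}). \<Prod>j\<in>J. ?c j (\<kappa> j) * int (F j x choose \<kappa> j))"
    using fin by (subst prod_sum_PiE) auto
  also have "\<dots> = (\<Sum>\<kappa>\<in>PiE J (\<lambda>_. {..K}). (\<Prod>j\<in>J. ?c j (\<kappa> j)) *
      (\<Sum>x\<in>?X. \<Prod>j\<in>J. int (F j x choose \<kappa> j)))"
    by (subst sum.swap) (simp add: prod.distrib sum_distrib_left)
  also have "int p ^ m dvd \<dots>"
  proof (rule dvd_sum)
    fix \<kappa>
    define e where "e j = (\<kappa> j - p ^ (b j - 1)) div ((p - 1) * p ^ (b j - 1))" for j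
    define D where "D = (\<Sum>j\<in>J. \<kappa> j * d j)"
    have p1: "p > 1"
      using prime_gt_1_nat[OF p] .
    have "(\<Prod>j\<in>J. int p ^ e j) dvd (\<Prod>j\<in>J. ?c j (\<kappa> j))"
      unfolding e_def by (intro prod_dvd_prod weisman p b)
    then have 1: "int p ^ (\<Sum>j\<in>J. e j) dvd (\<Prod>j\<in>J. ?c j (\<kappa> j))"
      by (simp add: power_sum)
    have "deg_le 0 I D (\<lambda>x. \<Prod>j\<in>J. int (F j x choose \<kappa> j))"
      unfolding D_def by (intro deg_le_prod deg_le_binomial F fin)
    then have 2: "int p ^ (card I - D div (p - 1)) dvd (\<Sum>x\<in>?X. \<Prod>j\<in>J. int (F j x choose \<kappa> j))"
      by (rule dvd_sum_box[OF p fin(1)])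
    \<comment> \<open>This inverts the floor in \<open>e j\<close>. Passing from \<open><\<close> to
      \<open>\<le>\<close> replaces \<open>p ^ b j\<close> by \<open>p ^ b j - 1\<close>, which is
      exactly \<open>(p - 1) * s j\<close>.\<close>
    have \<kappa>: "\<kappa> j \<le> (p - 1) * (s j + e j * p ^ (b j - 1))" if j: "j \<in> J" for j
    proof -
      let ?P = "p ^ (b j - 1)"
      have "(p - 1) * ?P + ?P = p ^ b j"
        using p1 b[OF j] by (cases "b j") (auto simp: algebra_simps)
      moreover have "\<kappa> j - ?P < (p - 1) * ?P + e j * ((p - 1) * ?P)"
        unfolding e_def using p1 by (intro dividend_less_div_times) simp
      ultimately have "\<kappa> j < p ^ b j + e j * ((p - 1) * ?P)"
        by linarith
      then have "\<kappa> j \<le> (p ^ b j - 1) + e j * ((p - 1) * ?P)"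
        by linarith
      also have "\<dots> = (p - 1) * (s j + e j * ?P)"
        unfolding s_def by (simp add: distrib_left power_pred_sum[unfolded One_nat_def])
      finally show ?thesis .
    qed
    have "D \<le> (\<Sum>j\<in>J. (p - 1) * (s j + e j * p ^ (b j - 1)) * d j)"
      unfolding D_def by (intro sum_mono mult_right_mono \<kappa>) auto
    also have "\<dots> = (\<Sum>j\<in>J. (p - 1) * (s j * d j + e j * (p ^ (b j - 1) * d j)))"
      by (simp add: algebra_simps)
    also have "\<dots> \<le> (\<Sum>j\<in>J. (p - 1) * (s j * d j + e j * M))"
      by (intro sum_mono mult_left_mono add_left_mono M) auto
    also have "\<dots> = (p - 1) * (S + (\<Sum>j\<in>J. e j) * M)"
      by (simp add: S_def sum.distrib flip: sum_distrib_left sum_distrib_right)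
    \<comment> \<open>Each factor \<open>p\<close> gained from the coefficients costs at most
      \<open>M\<close> factors from the box sum.\<close>
    finally have D: "D div (p - 1) \<le> S + (\<Sum>j\<in>J. e j) * M"
      using p1 by (metis div_le_mono nonzero_mult_div_cancel_left zero_less_diff less_irrefl)
    have "m \<le> (\<Sum>j\<in>J. e j) + (card I - D div (p - 1))"
    proof (cases "m \<le> (\<Sum>j\<in>J. e j)")
      case False
      \<comment> \<open>The box sum must still supply \<open>l + 1\<close> factors \<open>p\<close>;
        it does, since \<open>M \<ge> 1\<close> gives \<open>l \<le> l * M\<close>.\<close>
      then obtain l where l: "m - 1 = (\<Sum>j\<in>J. e j) + l"
        by (metis Suc_diff_1 le_Suc_ex less_Suc_eq_le not_le zero_less_iff_neq_zero zero_le)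
      have "l \<le> l * M"
        using \<open>M \<ge> 1\<close> by simp
      moreover have "S + ((\<Sum>j\<in>J. e j) + l) * M < card I"
        using m False unfolding S_def s_def l[symmetric] by simp
      ultimately show ?thesis
        using D l False unfolding distrib_right by linarith
    qed simp
    then have "int p ^ m dvd int p ^ (\<Sum>j\<in>J. e j) * int p ^ (card I - D div (p - 1))"
      by (simp add: le_imp_power_dvd flip: power_add)
    then show "int p ^ m dvd (\<Prod>j\<in>J. ?c j (\<kappa> j)) * (\<Sum>x\<in>?X. \<Prod>j\<in>J. int (F j x choose \<kappa> j))"
      using mult_dvd_mono[OF 1 2] by (rule dvd_trans)
  qed
  finally show ?thesis
    by (simp flip: of_nat_power)
qed

section \<open>From functional degrees on the group to degrees on the box\<close>

lemma fdeg_finiteE: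
  assumes "nonzero_fun A B f" "fdeg A B f \<noteq> \<infinity>"
  obtains d where "fdeg A B f = ereal (real d)"
    "\<And>as. set as \<subseteq> carrier A \<Longrightarrow> length as = Suc d \<Longrightarrow> \<not> nonzero_fun A B (foldr (fdiff A B) as f)"
proof -
  define P where "P n \<longleftrightarrow> (\<exists>as. length as = n \<and> set as \<subseteq> carrier A \<and>
    nonzero_fun A B (foldr (fdiff A B) as f))" for n
  have fdeg: "fdeg A B f = Sup {ereal (real n) | n. P n}"
    unfolding fdeg_def P_def ..
  have P0: "P 0"
    using assms(1) by (simp add: P_def)
  have le: "ereal (real n) \<le> fdeg A B f" if "P n" for n
    unfolding fdeg using that by (intro Sup_upper) auto
  obtain c where c: "fdeg A B f = ereal c"
    using assms(2) le[OF P0] by (cases "fdeg A B f") auto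
  have bound: "n \<le> nat \<lceil>c\<rceil>" if "P n" for n
    using le[OF that] unfolding c by (simp add: le_nat_iff) linarith
  \<comment> \<open>\<open>P 0\<close> and the bound from the finite supremum make that supremum a
    maximum.\<close>
  define d where "d = (GREATEST n. P n)"
  have d: "P d"
    unfolding d_def using P0 bound by (rule GreatestI_nat)
  have d_max: "n \<le> d" if "P n" for n
    unfolding d_def using that bound by (rule Greatest_le_nat)
  show ?thesis
  proof
    show "fdeg A B f = ereal (real d)"
      unfolding fdeg using d d_max by (intro Sup_eqI) auto
    show "\<not> nonzero_fun A B (foldr (fdiff A B) as f)"
      if "set as \<subseteq> carrier A" "length as = Suc d" for as
      using d_max[of "Suc d"] that unfolding P_def by auto
  qed
qed

text \<open>Any two points differ by a translation, so vanishing first differences force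
  \<open>f\<close> to be constant. This settles the case of a zero denominator.\<close>

lemma nonzero_fun_const:
  assumes "group A" "group B" and f: "f \<in> carrier A \<rightarrow> carrier B" and "nonzero_fun A B f"
    and d: "\<And>a. a \<in> carrier A \<Longrightarrow> \<not> nonzero_fun A B (fdiff A B a f)"
    and y: "y \<in> carrier A"
  shows "f y \<noteq> \<one>\<^bsub>B\<^esub>"
proof -
  interpret A: group A by fact
  interpret B: group B by fact
  obtain x where x: "x \<in> carrier A" "f x \<noteq> \<one>\<^bsub>B\<^esub>"
    using assms(4) by (auto simp: nonzero_fun_def)
  let ?a = "inv\<^bsub>A\<^esub> x \<otimes>\<^bsub>A\<^esub> y"
  have "fdiff A B ?a f x = \<one>\<^bsub>B\<^esub>"
    using d[of ?a] x y by (auto simp: nonzero_fun_def)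
  moreover have "x \<otimes>\<^bsub>A\<^esub> ?a = y"
    using x y by (simp add: A.m_assoc[symmetric])
  ultimately have "f y \<otimes>\<^bsub>B\<^esub> inv\<^bsub>B\<^esub> f x = \<one>\<^bsub>B\<^esub>"
    by (simp add: fdiff_def)
  then have "f y = f x"
    using f x y by (metis B.inv_equality B.inv_inv PiE B.inv_closed funcset_mem)
  with x show ?thesis by simp
qed

text \<open>Reduction is taken on all tuples, not only on the box, so that incrementing a coordinate
  equal to \<open>p - 1\<close> wraps around as addition in the group does.\<close>

definition box_proj :: "'i set \<Rightarrow> nat \<Rightarrow> ('i \<Rightarrow> nat) \<Rightarrow> 'i \<Rightarrow> int"
  where "box_proj I p x = (\<lambda>i\<in>I. int (x i mod p))"

lemma bij_betw_box_proj:
  assumes "p > 0"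
  shows "bij_betw (box_proj I p) (PiE I (\<lambda>_. {..<p}))
    (carrier (product_group I (\<lambda>_. integer_mod_group p)))"
proof (rule bij_betw_byWitness[where f' = "\<lambda>y. \<lambda>i\<in>I. nat (y i)"])
  show "\<forall>x\<in>PiE I (\<lambda>_. {..<p}). (\<lambda>i\<in>I. nat (box_proj I p x i)) = x"
    by (auto simp: box_proj_def PiE_iff extensional_def fun_eq_iff)
  show "\<forall>y\<in>carrier (product_group I (\<lambda>_. integer_mod_group p)).
      box_proj I p (\<lambda>i\<in>I. nat (y i)) = y"
    using assms
    by (auto simp: box_proj_def PiE_iff extensional_def fun_eq_iff carrier_integer_mod_group zmod_int)
  show "box_proj I p ` PiE I (\<lambda>_. {..<p}) \<subseteq> carrier (product_group I (\<lambda>_. integer_mod_group p))"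
    using assms by (auto simp: box_proj_def carrier_integer_mod_group)
  show "(\<lambda>y. \<lambda>i\<in>I. nat (y i)) ` carrier (product_group I (\<lambda>_. integer_mod_group p))
      \<subseteq> PiE I (\<lambda>_. {..<p})"
    using assms by (auto simp: PiE_iff carrier_integer_mod_group nat_less_iff)
qed

text \<open>Translation by the unit vector \<open>u i\<close> corresponds to \<open>pdiff i\<close>.
  As \<open>pdiff\<close> does not reduce modulo \<open>q\<close>, the induction carries a
  congruence between \<open>h\<close> and \<open>f\<close> rather than an equality.\<close>

lemma deg_le_of_fdiff:
  fixes I :: "'i set" and p q :: nat
  defines "A \<equiv> product_group I (\<lambda>_. integer_mod_group p)"
  defines "B \<equiv> integer_mod_group q"
  assumes p: "p > 1" and q: "q > 0"
    and "f \<in> carrier A \<rightarrow> carrier B"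
    and "\<And>as. set as \<subseteq> carrier A \<Longrightarrow> length as = Suc n \<Longrightarrow> \<not> nonzero_fun A B (foldr (fdiff A B) as f)"
    and "\<And>x. int q dvd h x - f (box_proj I p x)"
  shows "deg_le (int q) I n h"
proof -
  \<comment> \<open>For \<open>i\<close> outside \<open>I\<close> this is the identity of
    \<open>A\<close>, so \<open>shift\<close> holds for every \<open>i\<close>.\<close>
  define u where "u i = (\<lambda>j\<in>I. if j = i then 1 else 0 :: int)" for i
  have u: "u i \<in> carrier A" for i
    using p by (auto simp: u_def A_def carrier_integer_mod_group)
  have proj: "box_proj I p x \<in> carrier A" for x
    using p by (auto simp: box_proj_def A_def carrier_integer_mod_group)
  have shift: "box_proj I p x \<otimes>\<^bsub>A\<^esub> u i = box_proj I p (x(i := Suc (x i)))" for x i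
    by (auto simp: box_proj_def A_def u_def fun_eq_iff zmod_int mod_add_right_eq add.commute)
  have fdiff_closed: "fdiff A B (u i) g \<in> carrier A \<rightarrow> carrier B" for i g
    using q by (auto simp: fdiff_def B_def carrier_integer_mod_group)
  have fdiff_cong: "int q dvd pdiff i k x - fdiff A B (u i) g (box_proj I p x)"
    if g: "g \<in> carrier A \<rightarrow> carrier B" and k: "\<And>x. int q dvd k x - g (box_proj I p x)" for i k x g
  proof -
    let ?y = "box_proj I p x" and ?z = "box_proj I p (x(i := Suc (x i)))"
    have "g ?y \<in> carrier B"
      using g proj by auto
    then have "fdiff A B (u i) g ?y = (g ?z - g ?y) mod int q"
      unfolding fdiff_def shift by (simp add: B_def mod_add_right_eq)
    moreover have "int q dvd pdiff i k x - (g ?z - g ?y)"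
      using dvd_diff[OF k[of "x(i := Suc (x i))"] k[of x]] by (simp add: pdiff_def algebra_simps)
    ultimately show ?thesis
      by (simp add: mod_eq_dvd_iff[symmetric])
  qed
  show ?thesis
    using assms(5-7)
  proof (induction n arbitrary: f h)
    case 0
    have "int q dvd pdiff i h x" for i x
    proof -
      have "fdiff A B (u i) f (box_proj I p x) = 0"
        using 0(2)[of "[u i]"] u proj by (auto simp: nonzero_fun_def B_def)
      then show ?thesis
        using fdiff_cong[OF 0(1,3), of i x] by simp
    qed
    then show ?case by simp
  next
    case (Suc n)
    have "deg_le (int q) I n (pdiff i h)" for i
    proof (rule Suc.IH[of "fdiff A B (u i) f"])
      show "\<not> nonzero_fun A B (foldr (fdiff A B) as (fdiff A B (u i) f))"
        if "set as \<subseteq> carrier A" "length as = Suc n" for as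
        \<comment> \<open>\<open>foldr\<close> applies the last list element first, hence
          \<open>u i\<close> goes at the end.\<close>
        using Suc.prems(2)[of "as @ [u i]"] that u by simp
    qed (use fdiff_closed fdiff_cong[OF Suc.prems(1,3)] in auto)
    then show ?case by simp
  qed
qed

theorem theorem1p7:
  fixes N r p :: nat
    and \<beta> :: "nat \<Rightarrow> nat"
    and f :: "nat \<Rightarrow> (nat \<Rightarrow> int) \<Rightarrow> int"
    and A :: "(nat \<Rightarrow> int) monoid"
    and B :: "nat \<Rightarrow> int monoid"
    and Z :: "(nat \<Rightarrow> int) set"
    and M :: ereal
  defines "A \<equiv> product_group {1..N} (\<lambda>_. integer_mod_group p)"
    and "B \<equiv> (\<lambda>j. integer_mod_group (p ^ \<beta> j))"
    and "Z \<equiv> {x \<in> carrier A. \<forall>j\<in>{1..r}. f j x = \<one>\<^bsub>B j\<^esub>}"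
    and "M \<equiv> Max ((\<lambda>j. ereal (real (p ^ (\<beta> j - 1))) * fdeg A (B j) (f j)) ` {1..r})"
  assumes "N \<ge> 1" and "r \<ge> 1" and "\<And>j. j \<in> {1..r} \<Longrightarrow> \<beta> j \<ge> 1"
    and "prime p"
    and "\<And>j. j \<in> {1..r} \<Longrightarrow> f j \<in> carrier A \<rightarrow> carrier (B j)"
    and "\<And>j. j \<in> {1..r} \<Longrightarrow> nonzero_fun A (B j) (f j)"
  shows "ord_p p (int (card Z)) \<ge>
    (if M = 0 then \<infinity>
     else ereal_ceiling
       ((ereal (real N) - (\<Sum>j=1..r. ereal ((real p ^ \<beta> j - 1) / (real p - 1)) * fdeg A (B j) (f j)))
         / M))"
proof (cases "\<exists>j\<in>{1..r}. fdeg A (B j) (f j) = \<infinity>")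
  case True
  then obtain j where j: "j \<in> {1..r}" "fdeg A (B j) (f j) = \<infinity>"
    by blast
  have "p > 0"
    using \<open>prime p\<close> by (rule prime_gt_0_nat)
  then have "\<infinity> = ereal (real (p ^ (\<beta> j - 1))) * fdeg A (B j) (f j)"
    by (simp add: j)
  also have "\<dots> \<le> M"
    unfolding M_def using j(1) by (intro Max_ge finite_imageI imageI) simp_all
  finally have M: "M = \<infinity>"
    by simp
  \<comment> \<open>also for \<open>x = -\<infinity>\<close>, so an infinite degree makes the bound trivial\<close>
  have "x / M = 0" for x
    by (simp add: M divide_ereal_def)
  moreover have "ereal_ceiling 0 = 0"
    by (simp add: ereal_ceiling_def zero_ereal_def)
  ultimately show ?thesis
    by (simp add: M ord_p_def)
next
  case False
  have p: "p > 1" "p > 0"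
    using \<open>prime p\<close> prime_gt_1_nat prime_gt_0_nat by auto
  have "\<forall>j\<in>{1..r}. \<exists>d. fdeg A (B j) (f j) = ereal (real d) \<and>
    (\<forall>as. set as \<subseteq> carrier A \<longrightarrow> length as = Suc d \<longrightarrow> \<not> nonzero_fun A (B j) (foldr (fdiff A (B j)) as (f j)))"
    using False assms(10) by (metis fdeg_finiteE)
  then obtain d where fdeg: "\<And>j. j \<in> {1..r} \<Longrightarrow> fdeg A (B j) (f j) = ereal (real (d j))"
    and d: "\<And>j as. j \<in> {1..r} \<Longrightarrow> set as \<subseteq> carrier A \<Longrightarrow> length as = Suc (d j) \<Longrightarrow>
      \<not> nonzero_fun A (B j) (foldr (fdiff A (B j)) as (f j))"
    by metis
  \<comment> \<open>\<open>K\<close> and \<open>S\<close> are the denominator and the subtracted sum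
    as natural numbers, with geometric sums in place of quotients.\<close>
  define K where "K = Max ((\<lambda>j. p ^ (\<beta> j - 1) * d j) ` {1..r})"
  define S where "S = (\<Sum>j=1..r. (\<Sum>i<\<beta> j. p ^ i) * d j)"
  have "M = Max ((\<lambda>n. ereal (real n)) ` (\<lambda>j. p ^ (\<beta> j - 1) * d j) ` {1..r})"
    unfolding M_def image_image by (intro arg_cong[where f = Max] image_cong refl) (simp add: fdeg)
  also have "\<dots> = ereal (real K)"
    unfolding K_def using \<open>r \<ge> 1\<close> by (intro mono_Max_commute[symmetric] monoI) auto
  finally have M: "M = ereal (real K)" .
  have s: "(real p ^ b - 1) / (real p - 1) = real (\<Sum>i<b. p ^ i)" for b
    using power_diff_1_eq[of "real p" b] p by (simp add: field_simps)
  have S: "(\<Sum>j=1..r. ereal ((real p ^ \<beta> j - 1) / (real p - 1)) * fdeg A (B j) (f j)) = ereal (real S)"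
    unfolding S_def s by (simp add: fdeg)
  have K: "p ^ (\<beta> j - 1) * d j \<le> K" if "j \<in> {1..r}" for j
    unfolding K_def using that by (intro Max_ge) auto
  have group: "group A" "group (B j)" for j
    by (auto simp: A_def B_def)
  show ?thesis
  proof (cases "K = 0")
    \<comment> \<open>A zero maximum forces \<open>d 1 = 0\<close>, so \<open>f 1\<close> is a
      nonzero constant, \<open>Z\<close> is empty and its order is infinite.\<close>
    case True
    have 1: "1 \<in> {1..r}"
      using \<open>r \<ge> 1\<close> by simp
    have "d 1 = 0"
      using K[OF 1] True p by simp
    then have "\<not> nonzero_fun A (B 1) (fdiff A (B 1) a (f 1))" if "a \<in> carrier A" for a
      using d[OF 1, of "[a]"] that by simp
    then have "f 1 y \<noteq> \<one>\<^bsub>B 1\<^esub>" if "y \<in> carrier A" for y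
      using nonzero_fun_const[OF group assms(9,10)[OF 1]] that by blast
    then have "Z = {}"
      unfolding Z_def using 1 by blast
    then show ?thesis
      by (simp add: ord_p_def)
  next
    case False
    let ?X = "PiE {1..N} (\<lambda>_. {..<p})"
    \<comment> \<open>\<open>nat\<close> turns a negative ceiling into \<open>0\<close>, where the
      divisibility claim is trivial.\<close>
    define m where "m = nat \<lceil>(real N - real S) / real K\<rceil>"
    have "\<exists>F. deg_le 0 {1..N} (d j) (\<lambda>x. int (F x)) \<and>
        (\<forall>x\<in>?X. int (p ^ \<beta> j) dvd int (F x) - f j (box_proj {1..N} p x))" if j: "j \<in> {1..r}" for j
      using p d[OF j] assms(9)[OF j] unfolding A_def B_def
      by (intro deg_le_lift deg_le_of_fdiff) auto
    then obtain F where F: "\<And>j. j \<in> {1..r} \<Longrightarrow> deg_le 0 {1..N} (d j) (\<lambda>x. int (F j x))"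
      "\<And>j x. j \<in> {1..r} \<Longrightarrow> x \<in> ?X \<Longrightarrow> int (p ^ \<beta> j) dvd int (F j x) - f j (box_proj {1..N} p x)"
      by metis
    have bij: "bij_betw (box_proj {1..N} p) ?X (carrier A)"
      unfolding A_def using p by (intro bij_betw_box_proj)
    have zero_iff: "f j (box_proj {1..N} p x) = \<one>\<^bsub>B j\<^esub> \<longleftrightarrow> p ^ \<beta> j dvd F j x"
      if "j \<in> {1..r}" "x \<in> ?X" for j x
    proof -
      let ?v = "f j (box_proj {1..N} p x)"
      have "?v \<in> carrier (B j)"
        using assms(9)[OF that(1)] bij_betwE[OF bij] that(2) by auto
      then have "?v = int (F j x) mod int (p ^ \<beta> j)"
        using F(2)[OF that] p by (auto simp: B_def carrier_integer_mod_group mod_eq_dvd_iff[symmetric])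
      then show ?thesis
        by (simp add: B_def dvd_eq_mod_eq_0 flip: zmod_int of_nat_power)
    qed
    have "bij_betw (box_proj {1..N} p) {x \<in> ?X. \<forall>j\<in>{1..r}. p ^ \<beta> j dvd F j x} Z"
      unfolding Z_def using bij by (rule bij_betw_Collect) (use zero_iff in auto)
    then have card: "card Z = card {x \<in> ?X. \<forall>j\<in>{1..r}. p ^ \<beta> j dvd F j x}"
      by (rule bij_betw_same_card[symmetric])
    have "p ^ m dvd card Z"
      unfolding card
    proof (rule dvd_card_zeros[OF \<open>prime p\<close> _ _ assms(7) F(1) K])
      assume "m \<ge> 1"
      \<comment> \<open>Since \<open>m\<close> is a ceiling, \<open>m - 1\<close> lies strictly
        below the quotient; clearing the denominator \<open>K\<close> gives the required
        inequality.\<close>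
      then have "real (m - 1) < (real N - real S) / real K"
        unfolding m_def by linarith
      then have "real (S + (m - 1) * K) < real N"
        using False by (simp add: field_simps)
      then show "(\<Sum>j=1..r. (\<Sum>i<\<beta> j. p ^ i) * d j) + (m - 1) * K < card {1..N}"
        unfolding S_def by (simp only: of_nat_less_iff card_atLeastAtMost diff_Suc_1 add_diff_cancel_right')
    qed (use False in auto)
    then have dvd: "int p ^ m dvd int (card Z)"
      by (metis of_nat_dvd_iff of_nat_power)
    have "ereal (real_of_int \<lceil>(real N - real S) / real K\<rceil>) \<le> ord_p p (int (card Z))"
    proof (cases "card Z = 0")
      case False
      then have "m \<le> multiplicity (int p) (int (card Z))"
        using dvd \<open>prime p\<close> by (intro multiplicity_geI) auto
      then have "\<lceil>(real N - real S) / real K\<rceil> \<le> int (multiplicity (int p) (int (card Z)))"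
        unfolding m_def by linarith
      then have "real_of_int \<lceil>(real N - real S) / real K\<rceil> \<le> real (multiplicity (int p) (int (card Z)))"
        by (metis of_int_le_iff of_int_of_nat_eq)
      then show ?thesis
        using False by (simp only: ord_p_def ereal_less_eq of_nat_eq_0_iff if_False)
    qed (simp add: ord_p_def)
    then show ?thesis
      using False unfolding S M by (simp add: ereal_ceiling_def zero_ereal_def)
  qed
qed

end
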